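(* Let the cost (number of gates, depth, or number of non-Clifford gates) be modelled by $$a(\log p)^2\log q+b(\log p)^2+c\log p\log q+d\log p+e\log q+f,$$ with fitted parameters $a,b,c,d,e,f\in\mathbb{R}$. Put $\log q=\log p-1$ for a safe-prime group with modulus $p=p_{\mathrm{sp}}$, and $\log q=\chi\log p$ with $\chi\approx 1/10$ for a Schnorr group with modulus $p=p_{\mathrm{S}}$. Equating the two costs gives $$a\big((\log p_{\mathrm{sp}})^3-\chi(\log p_{\mathrm{S}})^3\big)+(-a+b+c)(\log p_{\mathrm{sp}})^2-(b+c\chi)(\log p_{\mathrm{S}})^2+(-c+d+e)\log p_{\mathrm{sp}}-(d+e\chi)\log p_{\mathrm{S}}-e=0 .$$ Ignoring the terms of order up to two in $\log p_{\mathrm{sp}}$ and $\log p_{\mathrm{S}}$ in this equation, one obtains the approximate relations $$(\log p_{\mathrm{sp}})^3\sim\chi(\log p_{\mathrm{S}})^3,\qquad \log p_{\mathrm{sp}}\sim\sqrt[3]{\chi}\,\log p_{\mathrm{S}} .$$ Since $\chi\approx1/10$, the two bit lengths differ by a factor of about two: regardless of the specific parameters, the strength of the Schnorr group is reduced to about half in terms of the bit length of $p$ in the safe-prime group. In particular, for the Schnorr group with $(|p|,|q|)=(2048,256)$ one has $\chi=1/8=1/2^3$, so $\log p_{\mathrm{sp}}\sim\tfrac12\log p_{\mathrm{S}}$; that is, under Shor's algorithm the cryptographic strength of a Schnorr group with $p$ of 2048 bits is almost equivalent to that of a safe-prime group with $p$ of 1024 bits.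
   Context: Logarithms are to base 2 and $|x|$ is the bit length of $x$. The cost is that of the quantum circuit of Shor's algorithm, built on ripple carry adders, for the discrete logarithm problem in a subgroup of prime order $q$ of $\mathbb{F}_p^\times$, $p$ prime; the cost model is an empirical formula whose parameters are fitted to generated circuits (all fitted values of $a$ are positive). A safe-prime group is one with $q=(p-1)/2$ prime. A Schnorr group is one whose sizes $(|p|,|q|)$ are chosen so that the classical costs of the number field sieve (determined by $p$) and of square-root methods (determined by $q$) match; the standardized sizes $(1024,160),(2048,224),(2048,256),(3072,256)$ give approximately $\log q=\chi\log p$ with $\chi\approx1/10$. "Strength" means the modelled cost above. The symbol $\sim$ denotes the heuristic approximation obtained by dropping the lower-order terms as stated; no limit theorem or error bound is asserted. *)

theory Defs
  imports
    Complex_Main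
    "HOL-Library.Log_Nat"
    "HOL-Computational_Algebra.Polynomial"
    "HOL-Computational_Algebra.Primes"
begin

text \<open>
  The cost model, in terms of \<open>lp\<close> (for \<open>log p\<close>) and \<open>lq\<close> (for \<open>log q\<close>). It is stated over
  any commutative ring so that the same formula can be read numerically (over the reals) and
  formally (over polynomials in the logarithms of the moduli). Substituting \<open>lq = lp - 1\<close>
  gives the safe-prime cost, and \<open>lq = \<chi> * lp\<close> the Schnorr cost.
\<close>

definition shor_cost ::
  "'r::comm_ring_1 \<Rightarrow> 'r \<Rightarrow> 'r \<Rightarrow> 'r \<Rightarrow> 'r \<Rightarrow> 'r \<Rightarrow> 'r \<Rightarrow> 'r \<Rightarrow> 'r" where
  "shor_cost a b c d e f lp lq =
     a * lp ^ 2 * lq + b * lp ^ 2 + c * lp * lq + d * lp + e * lq + f"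

text \<open>
  Real polynomials in two indeterminates, as polynomials in \<open>X\<close> (standing for
  \<open>log p\<^sub>s\<^sub>p\<close>) with coefficients polynomials in \<open>Y\<close> (standing for \<open>log p\<^sub>S\<close>).
\<close>

definition const2 :: "real \<Rightarrow> real poly poly" where
  "const2 r = [:[:r:]:]"

definition indet_X :: "real poly poly" where
  "indet_X = [:0, 1:]"

definition indet_Y :: "real poly poly" where
  "indet_Y = [:[:0, 1:]:]"

definition eval2 :: "real poly poly \<Rightarrow> real \<Rightarrow> real \<Rightarrow> real" where
  "eval2 P x y = poly (poly P [:x:]) y"

definition drop_terms_upto :: "nat \<Rightarrow> real poly poly \<Rightarrow> real poly poly" where
  "drop_terms_upto n P =
     (\<Sum>i\<le>degree P. \<Sum>j\<le>degree (coeff P i).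
        if i + j \<le> n then 0 else monom (monom (coeff (coeff P i) j) j) i)"

definition cost_difference ::
  "real \<Rightarrow> real \<Rightarrow> real \<Rightarrow> real \<Rightarrow> real \<Rightarrow> real \<Rightarrow> real \<Rightarrow> real poly poly" where
  "cost_difference a b c d e f \<chi> =
     shor_cost (const2 a) (const2 b) (const2 c) (const2 d) (const2 e) (const2 f)
       indet_X (indet_X - 1)
     - shor_cost (const2 a) (const2 b) (const2 c) (const2 d) (const2 e) (const2 f)
       indet_Y (const2 \<chi> * indet_Y)"

text \<open>
  The heuristic equality of strength: the equation ``cost difference \<open>= 0\<close>'' after its terms
  of total order at most two have been ignored. The sign \<open>\<sim>\<close> between functions of
  \<open>log p\<^sub>s\<^sub>p\<close> and \<open>log p\<^sub>S\<close> means exactly that equality holds under this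
  truncated equation; it carries no limit and no error bound.
\<close>

definition same_strength_approx ::
  "real \<Rightarrow> real \<Rightarrow> real \<Rightarrow> real \<Rightarrow> real \<Rightarrow> real \<Rightarrow> real \<Rightarrow> real \<Rightarrow> real \<Rightarrow> bool" where
  "same_strength_approx a b c d e f \<chi> L_sp L_S \<longleftrightarrow>
     eval2 (drop_terms_upto 2 (cost_difference a b c d e f \<chi>)) L_sp L_S = 0"

text \<open>
  The qualifier ``about'' is read as: within 15 percent. The approximation
  \<open>\<chi> \<approx> 1/10\<close> is read as: \<open>\<chi>\<close> lies in the range spanned by the ratios
  \<open>|q| / |p|\<close> of the standardized sizes, whose extremes are \<open>256/3072 = 1/12\<close>
  and \<open>160/1024 = 5/32\<close>.
\<close>

definition about :: "real \<Rightarrow> real \<Rightarrow> bool" where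
  "about u v \<longleftrightarrow> \<bar>u - v\<bar> \<le> 15 / 100 * \<bar>v\<bar>"

definition approx_tenth :: "real \<Rightarrow> bool" where
  "approx_tenth \<chi> \<longleftrightarrow> 1 / 12 \<le> \<chi> \<and> \<chi> \<le> 5 / 32"

definition standard_schnorr_sizes :: "(nat \<times> nat) set" where
  "standard_schnorr_sizes = {(1024, 160), (2048, 224), (2048, 256), (3072, 256)}"

definition safe_prime_group :: "nat \<Rightarrow> nat \<Rightarrow> bool" where
  "safe_prime_group p q \<longleftrightarrow> prime p \<and> prime q \<and> q = (p - 1) div 2"

text \<open>
  The condition \<open>q dvd p - 1\<close> says that the cyclic group of units modulo \<open>p\<close> has a
  (unique) subgroup of order \<open>q\<close>.
\<close>

definition schnorr_group :: "nat \<times> nat \<Rightarrow> nat \<Rightarrow> nat \<Rightarrow> bool" where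
  "schnorr_group sizes p q \<longleftrightarrow> prime p \<and> prime q \<and> q dvd p - 1 \<and>
     bitlen (int p) = int (fst sizes) \<and> bitlen (int q) = int (snd sizes)"

definition size_ratio :: "nat \<times> nat \<Rightarrow> real" where
  "size_ratio sizes = real (snd sizes) / real (fst sizes)"

end

theory Submission
  imports Defs
begin

text \<open>Put \<open>X\<close> for the logarithm of the safe-prime modulus and \<open>Y\<close>
  for that of the Schnorr modulus. The difference of the two costs is a cubic in \<open>X\<close>
  and \<open>Y\<close> in which \<open>f\<close> cancels, and its only terms of order three are
  \<open>a * X^3\<close> and \<open>- a * \<chi> * Y^3\<close> (\<open>cost_difference_eq\<close>,
  \<open>drop_terms_upto_cost_difference\<close>). As \<open>a \<noteq> 0\<close>, the truncated
  equation says \<open>X^3 = \<chi> * Y^3\<close>, whatever the other parameters are, and taking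
  real cube roots gives the linear relation.\<close>

lemma coeff_drop_terms_upto:
  "coeff (coeff (drop_terms_upto n P) i) j = (if i + j \<le> n then 0 else coeff (coeff P i) j)"
proof -
  let ?g = "\<lambda>i j. if i + j \<le> n then 0 else coeff (coeff P i) j"
  have "coeff (coeff (drop_terms_upto n P) i) j =
      (\<Sum>k\<le>degree P. \<Sum>l\<le>degree (coeff P k).
         coeff (coeff (if k + l \<le> n then 0 else monom (monom (coeff (coeff P k) l) l) k) i) j)"
    by (simp add: drop_terms_upto_def coeff_sum)
  also have "\<dots> = (\<Sum>k\<le>degree P. \<Sum>l\<le>degree (coeff P k).
      if k = i then if l = j then ?g i j else 0 else 0)"
    by (intro sum.cong refl) auto
  also have "\<dots> = (\<Sum>k\<le>degree P. if k = i then
      \<Sum>l\<le>degree (coeff P i). if l = j then ?g i j else 0 else 0)"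
    by (intro sum.cong refl) auto
  \<comment> \<open>If \<open>i\<close> or \<open>j\<close> lies outside the range of summation, the
    sum is 0, and so is the coefficient of \<open>P\<close>.\<close>
  also have "\<dots> = ?g i j"
    by (auto simp: coeff_eq_0 not_le)
  finally show ?thesis .
qed

text \<open>The normal form from which all later facts are read off: outer list by powers of
  \<open>X\<close>, inner lists by powers of \<open>Y\<close>. The terms in \<open>- a\<close>,
  \<open>- c\<close> and \<open>- e\<close> come from the -1 in \<open>indet_X - 1\<close>.\<close>

lemma cost_difference_eq:
  "cost_difference a b c d e f \<chi> =
     [:[:- e, - (d + e * \<chi>), - (b + c * \<chi>), - (a * \<chi>):], [:- c + d + e:], [:- a + b + c:], [:a:]:]"
  by (simp add: cost_difference_def shor_cost_def const2_def indet_X_def indet_Y_def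
      power2_eq_square one_pCons algebra_simps)

lemma drop_terms_upto_cost_difference:
  "drop_terms_upto 2 (cost_difference a b c d e f \<chi>) = [:[:0, 0, 0, - (a * \<chi>):], 0, 0, [:a:]:]"
  by (intro poly_eqI)
    (auto simp: coeff_drop_terms_upto cost_difference_eq coeff_pCons split: nat.splits)

lemma eval2_cost_difference:
  "eval2 (cost_difference a b c d e f \<chi>) x y =
     a * (x ^ 3 - \<chi> * y ^ 3) + (- a + b + c) * x ^ 2 - (b + c * \<chi>) * y ^ 2
     + (- c + d + e) * x - (d + e * \<chi>) * y - e"
  by (simp add: eval2_def cost_difference_eq algebra_simps power2_eq_square power3_eq_cube)

lemma eval2_drop_terms_upto_cost_difference:
  "eval2 (drop_terms_upto 2 (cost_difference a b c d e f \<chi>)) x y = a * (x ^ 3 - \<chi> * y ^ 3)"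
  by (simp add: eval2_def drop_terms_upto_cost_difference algebra_simps power3_eq_cube)

lemma same_strength_approx_iff_cube:
  assumes "a \<noteq> 0"
  shows "same_strength_approx a b c d e f \<chi> x y \<longleftrightarrow> x ^ 3 = \<chi> * y ^ 3"
  using assms by (simp add: same_strength_approx_def eval2_drop_terms_upto_cost_difference)

text \<open>Cubing is a bijection of the reals, so no sign condition on \<open>\<chi>\<close>,
  \<open>x\<close> or \<open>y\<close> is called for.\<close>

lemma same_strength_approx_iff_root:
  assumes "a \<noteq> 0"
  shows "same_strength_approx a b c d e f \<chi> x y \<longleftrightarrow> x = root 3 \<chi> * y"
proof -
  have "\<chi> * y ^ 3 = (root 3 \<chi> * y) ^ 3"
    by (simp add: power_mult_distrib odd_real_root_pow)
  then show ?thesis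
    using assms by (metis same_strength_approx_iff_cube odd_real_root_power_cancel odd_numeral)
qed

lemma root_3_eighth: "root 3 (1 / 8) = 1 / 2"
  by (rule real_root_pos_unique) (simp_all add: power3_eq_cube)

lemma same_strength_approx_eighth:
  assumes "a \<noteq> 0"
  shows "same_strength_approx a b c d e f (size_ratio (2048, 256)) x y \<longleftrightarrow> x = 1 / 2 * y"
proof -
  have "size_ratio (2048, 256) = 1 / 8"
    by (simp add: size_ratio_def)
  then show ?thesis
    by (simp only: same_strength_approx_iff_root [OF assms] root_3_eighth)
qed

text \<open>The ratio \<open>t = x / y\<close> satisfies \<open>t ^ 3 = \<chi>\<close>, so both
  claims reduce to rational bounds on \<open>t\<close>, checked by cubing.\<close>

lemma about_half:
  fixes x y \<chi> :: real
  assumes "0 < x" "0 < y" "approx_tenth \<chi>" and eq: "x ^ 3 = \<chi> * y ^ 3"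
  shows "about (y / x) 2" and "about (x / y) (1 / 2)"
proof -
  define t where "t = x / y"
  have "0 < t"
    using assms by (simp add: t_def)
  have "t ^ 3 = \<chi>"
    using assms by (simp add: t_def power_divide)
  then have bounds: "1 / 12 \<le> t ^ 3" "t ^ 3 \<le> 5 / 32"
    using assms by (simp_all add: approx_tenth_def)
  \<comment> \<open>\<open>10/23\<close> is the reciprocal of the upper tolerance \<open>2 * 1.15\<close>; \<open>27/50\<close> is a rational
    upper bound for the cube root of \<open>5/32\<close> with room to spare below the tolerance.\<close>
  have lower: "10 / 23 \<le> t"
  proof (rule power_le_imp_le_base)
    show "(10 / 23) ^ Suc 2 \<le> t ^ Suc 2"
      using bounds(1) by (simp add: eval_nat_numeral)
  qed (use \<open>0 < t\<close> in simp)
  have upper: "t \<le> 27 / 50"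
  proof (rule power_le_imp_le_base)
    show "t ^ Suc 2 \<le> (27 / 50) ^ Suc 2"
      using bounds(2) by (simp add: eval_nat_numeral)
  qed simp
  show "about (x / y) (1 / 2)"
    using lower upper by (simp only: about_def t_def [symmetric] abs_le_iff) simp
  \<comment> \<open>These are the ends of the 15 percent tolerance around 2; the lower one has
    slack, since 50/27 exceeds 17/10.\<close>
  have "17 / 10 \<le> 1 / t" "1 / t \<le> 23 / 10"
    using lower upper \<open>0 < t\<close> by (simp_all add: field_simps)
  moreover have "y / x = 1 / t"
    by (simp add: t_def)
  ultimately show "about (y / x) 2"
    by (simp only: about_def abs_le_iff) simp
qed

text \<open>For positive \<open>p\<close> the bit length is one more than the floor of the binary
  logarithm.\<close>

lemma log_bounds_bitlen:
  assumes "0 < p" "bitlen (int p) = int n"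
  shows "real n - 1 \<le> log 2 (real p)" and "log 2 (real p) < real n"
proof -
  have "\<lfloor>log 2 (real p)\<rfloor> = int n - 1"
    using assms by (simp add: bitlen_alt_def)
  then show "real n - 1 \<le> log 2 (real p)" and "log 2 (real p) < real n"
    by linarith+
qed

theorem mainTheorem1:
  fixes a b c d e f \<chi> L_sp L_S :: real
  assumes "0 < a" and "0 < \<chi>" and "0 < L_sp" and "0 < L_S"
  shows
    "(shor_cost a b c d e f L_sp (L_sp - 1) = shor_cost a b c d e f L_S (\<chi> * L_S) \<longleftrightarrow>
        a * (L_sp ^ 3 - \<chi> * L_S ^ 3) + (- a + b + c) * L_sp ^ 2 - (b + c * \<chi>) * L_S ^ 2
        + (- c + d + e) * L_sp - (d + e * \<chi>) * L_S - e = 0)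
     \<and> eval2 (cost_difference a b c d e f \<chi>) L_sp L_S =
        a * (L_sp ^ 3 - \<chi> * L_S ^ 3) + (- a + b + c) * L_sp ^ 2 - (b + c * \<chi>) * L_S ^ 2
        + (- c + d + e) * L_sp - (d + e * \<chi>) * L_S - e
     \<and> eval2 (drop_terms_upto 2 (cost_difference a b c d e f \<chi>)) L_sp L_S =
        a * (L_sp ^ 3 - \<chi> * L_S ^ 3)
     \<and> (same_strength_approx a b c d e f \<chi> L_sp L_S \<longleftrightarrow> L_sp ^ 3 = \<chi> * L_S ^ 3)
     \<and> (same_strength_approx a b c d e f \<chi> L_sp L_S \<longleftrightarrow> L_sp = root 3 \<chi> * L_S)
     \<and> approx_tenth (1 / 10)
     \<and> (\<forall>s \<in> standard_schnorr_sizes. approx_tenth (size_ratio s))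
     \<and> (approx_tenth \<chi> \<and> same_strength_approx a b c d e f \<chi> L_sp L_S \<longrightarrow>
          about (L_S / L_sp) 2 \<and> about (L_sp / L_S) (1 / 2))
     \<and> size_ratio (2048, 256) = 1 / 8 \<and> (1 / 8 :: real) = 1 / 2 ^ 3
     \<and> (same_strength_approx a b c d e f (size_ratio (2048, 256)) L_sp L_S \<longleftrightarrow>
          L_sp = 1 / 2 * L_S)
     \<and> (\<forall>p_S q_S. schnorr_group (2048, 256) p_S q_S \<longrightarrow>
          (same_strength_approx a b c d e f (size_ratio (2048, 256)) L_sp (log 2 (real p_S)) \<longrightarrow>
             \<lfloor>L_sp\<rfloor> + 1 = 1024)
          \<and> (\<forall>p_sp q_sp. safe_prime_group p_sp q_sp \<longrightarrow>
               (same_strength_approx a b c d e f (size_ratio (2048, 256))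
                  (real_of_int (bitlen (int p_sp))) (real_of_int (bitlen (int p_S)))
                \<longleftrightarrow> bitlen (int p_sp) = 1024)))"
proof -
  have a: "a \<noteq> 0"
    using assms by simp
  have ratios: "\<forall>s \<in> standard_schnorr_sizes. approx_tenth (size_ratio s)"
    by (simp add: standard_schnorr_sizes_def approx_tenth_def size_ratio_def)
  have schnorr: "(same_strength_approx a b c d e f (size_ratio (2048, 256)) L_sp (log 2 (real p_S))
          \<longrightarrow> \<lfloor>L_sp\<rfloor> + 1 = 1024)
        \<and> (\<forall>p_sp q_sp. safe_prime_group p_sp q_sp \<longrightarrow>
             (same_strength_approx a b c d e f (size_ratio (2048, 256))
                (real_of_int (bitlen (int p_sp))) (real_of_int (bitlen (int p_S)))
              \<longleftrightarrow> bitlen (int p_sp) = 1024))"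
    if "schnorr_group (2048, 256) p_S q_S" for p_S q_S
  proof -
    have len: "bitlen (int p_S) = int 2048" and "0 < p_S"
      using that by (auto simp: schnorr_group_def prime_gt_0_nat)
    then have "2047 \<le> log 2 (real p_S)" "log 2 (real p_S) < 2048"
      using log_bounds_bitlen [of p_S 2048] by simp_all
    \<comment> \<open>Halving the interval from 2047 to 2048 leaves values from 1023.5 up to but
      excluding 1024, that is, a bit length of 1024.\<close>
    then have "\<lfloor>1 / 2 * log 2 (real p_S)\<rfloor> = 1023"
      by (simp add: floor_eq_iff)
    \<comment> \<open>For bit lengths in place of logarithms the relation is exact: half of 2048 is
      1024.\<close>
    then show ?thesis
      using len a by (auto simp only: same_strength_approx_eighth [OF a])
  qed
  show ?thesis
    using assms schnorr a
    by (intro conjI allI impI ratios eval2_cost_difference eval2_drop_terms_upto_cost_difference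
        same_strength_approx_iff_cube same_strength_approx_iff_root same_strength_approx_eighth
        about_half [of L_sp L_S \<chi>])
      (auto simp: shor_cost_def approx_tenth_def size_ratio_def same_strength_approx_iff_cube
        algebra_simps power2_eq_square power3_eq_cube)
qed

end
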